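(* Every finite digraph with minimum out-degree at least $3$ has at least $2$ distinct friendly partitions.
   Context: Digraphs have no loops and no parallel arcs in the same direction. A friendly partition of a digraph $G=(V,E)$ is an (unordered) partition $\{V_1,V_2\}$ of $V$ into two nonempty sets such that every vertex has at least one out-neighbor in its own part. *)

theory Defs
  imports "Graph_Theory.Digraph" "HOL-Library.Disjoint_Sets"
begin

(* Meaningful only when the vertex set is finite and nonempty. *)
definition min_out_degree :: "('a, 'b) pre_digraph \<Rightarrow> nat" where
  "min_out_degree G = Min (out_degree G ` verts G)"

(* A partition is a set of parts, hence unordered; partition_on already excludes empty parts. *)
definition friendly_partition :: "('a, 'b) pre_digraph \<Rightarrow> 'a set set \<Rightarrow> bool" where
  "friendly_partition G P \<longleftrightarrow>
     partition_on (verts G) P \<and> card P = 2 \<and>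
     (\<forall>X\<in>P. \<forall>v\<in>X. \<exists>w\<in>X. v \<rightarrow>\<^bsub>G\<^esub> w)"

end

theory Submission
  imports Defs
begin

text \<open>
  Keep exactly three out-neighbours of every vertex and argue by induction on the number of
  vertices. Two disjoint nonempty sets without internal sinks always extend to a friendly
  partition, so it suffices to find two such pairs that no single partition separates.

  Suppose there is a digon \<open>{x, y}\<close>; its complement has no sink. Moving a further in-neighbour
  \<open>v\<close> of the digon to its side fails only if some \<open>u\<close> has out-neighbourhood \<open>{x, y, v}\<close>; counting
  then shows that the set \<open>Z\<close> of in-neighbours of the digon is permuted by \<open>u \<mapsto> v\<close>, and that all of
  \<open>Z\<close> dominates both \<open>x\<close> and \<open>y\<close>. The remaining vertices span an acyclic digraph, through which
  disjoint paths lead from \<open>x\<close> and \<open>y\<close> to \<open>Z\<close>, and these close up to disjoint cycles separating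
  \<open>x\<close> from \<open>y\<close>.

  Without digons, an arc whose ends have no common in-neighbour can be contracted (Thomassen).
  Otherwise every in-neighbourhood has no internal source, so it has at least three elements, and
  by double counting it is exactly a directed triangle. A triangle whose complement has a sink
  \<open>w\<close> is the out-neighbourhood of \<open>w\<close>, and the in-neighbourhood of \<open>w\<close> is a triangle disjoint from
  it. Applying this to two triangles meeting in one vertex yields two partitions.
\<close>

section \<open>Sinkless sets and their extension to friendly partitions\<close>

definition sinkless :: "('a \<Rightarrow> 'a set) \<Rightarrow> 'a set \<Rightarrow> bool" where
  "sinkless N A \<longleftrightarrow> (\<forall>v\<in>A. N v \<inter> A \<noteq> {})"

definition friendly_side :: "'a set \<Rightarrow> ('a \<Rightarrow> 'a set) \<Rightarrow> 'a set \<Rightarrow> bool" where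
  "friendly_side V N A \<longleftrightarrow>
     A \<subseteq> V \<and> A \<noteq> {} \<and> V - A \<noteq> {} \<and> sinkless N A \<and> sinkless N (V - A)"

definition two_friendly :: "'a set \<Rightarrow> ('a \<Rightarrow> 'a set) \<Rightarrow> bool" where
  "two_friendly V N \<longleftrightarrow>
     (\<exists>A B. friendly_side V N A \<and> friendly_side V N B \<and> B \<noteq> A \<and> B \<noteq> V - A)"

lemma two_friendlyI:
  "\<lbrakk>friendly_side V N A; friendly_side V N B; B \<noteq> A; B \<noteq> V - A\<rbrakk> \<Longrightarrow> two_friendly V N"
  unfolding two_friendly_def by blast

definition out_regular3 :: "'a set \<Rightarrow> ('a \<Rightarrow> 'a set) \<Rightarrow> bool" where
  "out_regular3 V N \<longleftrightarrow> (\<forall>v\<in>V. N v \<subseteq> V \<and> v \<notin> N v \<and> card (N v) = 3)"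

lemma out_regular3D:
  assumes "out_regular3 V N" "v \<in> V"
  shows "N v \<subseteq> V" "v \<notin> N v" "card (N v) = 3" "finite (N v)" "N v \<noteq> {}"
proof -
  show *: "N v \<subseteq> V" "v \<notin> N v" "card (N v) = 3" using assms by (auto simp: out_regular3_def)
  show "finite (N v)" by (rule card_ge_0_finite) (simp add: *(3))
  show "N v \<noteq> {}" using *(3) by auto
qed

lemma extend_to_friendly_side:
  assumes reg: "out_regular3 V N"
    and AB: "A \<subseteq> V" "B \<subseteq> V" "A \<inter> B = {}" "A \<noteq> {}" "B \<noteq> {}" "sinkless N A" "sinkless N B"
  obtains S where "friendly_side V N S" "A \<subseteq> S" "B \<subseteq> V - S"
proof -
  \<comment> \<open>For the largest sinkless set avoiding \<open>B\<close>, no outside vertex except those in \<open>B\<close> has an arc into it.\<close>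
  define S where "S = \<Union>{X. X \<subseteq> V - B \<and> sinkless N X}"
  have S: "S \<subseteq> V - B" "A \<subseteq> S" unfolding S_def using AB by blast+
  have sS: "sinkless N S" unfolding S_def sinkless_def by blast
  have "sinkless N (V - S)"
    unfolding sinkless_def
  proof
    fix v assume v: "v \<in> V - S"
    show "N v \<inter> (V - S) \<noteq> {}"
    proof (cases "v \<in> B")
      case True
      then show ?thesis using AB S(1) unfolding sinkless_def by blast
    next
      case False
      have "N v \<inter> S = {}"
      proof (rule ccontr)
        assume "N v \<inter> S \<noteq> {}"
        then have "sinkless N (insert v S)" using sS unfolding sinkless_def by blast
        moreover have "insert v S \<subseteq> V - B" using v False S(1) by blast
        ultimately have "v \<in> S" using S_def by blast
        then show False using v by blast
      qed
      then show ?thesis using out_regular3D(1,5)[OF reg, of v] v by blast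
    qed
  qed
  then have "friendly_side V N S" using S sS AB unfolding friendly_side_def by blast
  then show thesis using that S AB by blast
qed

text \<open>The two parts of a friendly partition of \<open>W\<close> extend to one of
  \<open>V\<close> whose trace on \<open>W\<close> recovers them, so different partitions stay
  different.\<close>

lemma two_friendly_closed_subset:
  assumes reg: "out_regular3 V N" and "W \<subseteq> V" and "two_friendly W N"
  shows "two_friendly V N"
proof -
  obtain A B where AB: "friendly_side W N A" "friendly_side W N B" "B \<noteq> A" "B \<noteq> W - A"
    using assms(3) unfolding two_friendly_def by blast
  have *: "\<exists>S. friendly_side V N S \<and> S \<inter> W = X" if "friendly_side W N X" for X
  proof -
    have "X \<subseteq> V" "W - X \<subseteq> V" "X \<inter> (W - X) = {}" "X \<noteq> {}" "W - X \<noteq> {}"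
      "sinkless N X" "sinkless N (W - X)"
      using that assms(2) unfolding friendly_side_def by auto
    then obtain S where "friendly_side V N S" "X \<subseteq> S" "W - X \<subseteq> V - S"
      by (rule extend_to_friendly_side[OF reg])
    then show ?thesis using that unfolding friendly_side_def by (intro exI[of _ S]) blast
  qed
  obtain S T where "friendly_side V N S" "S \<inter> W = A" "friendly_side V N T" "T \<inter> W = B"
    using *[OF AB(1)] *[OF AB(2)] by blast
  then show ?thesis using AB(3,4) assms(2) by (intro two_friendlyI[of V N S T]) blast+
qed

section \<open>Cycles and disjoint paths\<close>

text \<open>Following arcs backwards inside the finite \<open>Y\<close> never ends, so some
  \<open>a\<close> lies on a cycle; the strong component of \<open>a\<close> is sinkless.\<close>

lemma sourceless_imp_sinkless_subset:
  assumes "finite Y" "Y \<noteq> {}" "\<And>r. r \<in> Y \<Longrightarrow> \<exists>y\<in>Y. r \<in> N y"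
  obtains C where "C \<subseteq> Y" "C \<noteq> {}" "sinkless N C"
proof -
  define E where "E = {(y, r). y \<in> Y \<and> r \<in> Y \<and> r \<in> N y}"
  have "E \<subseteq> Y \<times> Y" unfolding E_def by blast
  then have "finite E" using assms(1) by (meson finite_SigmaI finite_subset)
  have "\<not> acyclic E"
  proof
    assume "acyclic E"
    then have "wf E" using \<open>finite E\<close> finite_acyclic_wf by blast
    then obtain r where "r \<in> Y" "\<And>y. (y, r) \<in> E \<Longrightarrow> y \<notin> Y"
      using assms(2) by (metis ex_in_conv wfE_min)
    then show False using assms(3)[of r] unfolding E_def by blast
  qed
  then obtain a where a: "(a, a) \<in> E\<^sup>+" unfolding acyclic_def by blast
  define C where "C = {b. (a, b) \<in> E\<^sup>+ \<and> (b, a) \<in> E\<^sup>+}"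
  have "C \<subseteq> Y"
  proof
    fix b assume "b \<in> C"
    then have "(b, a) \<in> E\<^sup>+" unfolding C_def by simp
    from tranclD[OF this] obtain c where "(b, c) \<in> E" by blast
    then show "b \<in> Y" unfolding E_def by blast
  qed
  moreover have "C \<noteq> {}" using a unfolding C_def by blast
  moreover have "sinkless N C"
    unfolding sinkless_def
  proof
    fix b assume b: "b \<in> C"
    then have ab: "(a, b) \<in> E\<^sup>+" and ba: "(b, a) \<in> E\<^sup>+" unfolding C_def by auto
    from tranclD[OF ba] obtain c where c: "(b, c) \<in> E" "(c, a) \<in> E\<^sup>*" by blast
    have "(c, a) \<in> E\<^sup>+" using c(2) a by (rule rtrancl_trancl_trancl)
    moreover have "(a, c) \<in> E\<^sup>+" using ab c(1) by (rule trancl.trancl_into_trancl)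
    ultimately show "N b \<inter> C \<noteq> {}" using c(1) unfolding C_def E_def by blast
  qed
  ultimately show thesis using that by blast
qed

text \<open>
  The sets \<open>A\<close> and \<open>B\<close> play the role of disjoint paths from \<open>u\<close> and \<open>v\<close> to \<open>Z\<close> through the acyclic
  part \<open>X\<close>. Induct by removing a source \<open>r\<close> of \<open>X\<close>: a path starting at \<open>r\<close> moves on to an
  out-neighbour different from the other starting point.
\<close>

lemma disjoint_linkage:
  assumes "finite X" "X \<inter> Z = {}"
    and "\<And>r. r \<in> X \<Longrightarrow> N r \<subseteq> X \<union> Z \<and> r \<notin> N r \<and> 2 \<le> card (N r)"
    and "\<And>Y. Y \<subseteq> X \<Longrightarrow> Y \<noteq> {} \<Longrightarrow> \<exists>r\<in>Y. \<forall>y\<in>Y. r \<notin> N y"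
    and "u \<in> X \<union> Z" "v \<in> X \<union> Z" "u \<noteq> v"
  shows "\<exists>A B. A \<subseteq> X \<union> Z \<and> B \<subseteq> X \<union> Z \<and> A \<inter> B = {} \<and> u \<in> A \<and> v \<in> B \<and>
           (\<forall>r\<in>A \<inter> X. N r \<inter> A \<noteq> {}) \<and> (\<forall>r\<in>B \<inter> X. N r \<inter> B \<noteq> {})"
  using assms
proof (induction "card X" arbitrary: X u v)
  case 0
  then show ?case by (intro exI[of _ "{u}"] exI[of _ "{v}"]) auto
next
  case (Suc n)
  then have "X \<noteq> {}" by auto
  then obtain r where r: "r \<in> X" "\<And>y. y \<in> X \<Longrightarrow> r \<notin> N y" using Suc.prems(4)[of X] by blast
  define X' where "X' = X - {r}"
  have X': "X' \<subseteq> X" unfolding X'_def by blast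
  have IH: "\<exists>A B. A \<subseteq> X' \<union> Z \<and> B \<subseteq> X' \<union> Z \<and> A \<inter> B = {} \<and> p \<in> A \<and> q \<in> B \<and>
           (\<forall>r\<in>A \<inter> X'. N r \<inter> A \<noteq> {}) \<and> (\<forall>r\<in>B \<inter> X'. N r \<inter> B \<noteq> {})"
    if "p \<in> X' \<union> Z" "q \<in> X' \<union> Z" "p \<noteq> q" for p q
  proof (rule Suc.hyps(1))
    show "n = card X'" using Suc.hyps(2) r(1) Suc.prems(1) unfolding X'_def by simp
    show "finite X'" using Suc.prems(1) X' finite_subset by blast
    show "X' \<inter> Z = {}" using Suc.prems(2) X' by blast
    \<comment> \<open>No vertex of \<open>X'\<close> has an arc to the source \<open>r\<close>, so
      removing \<open>r\<close> costs no out-neighbours.\<close>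
    show "N s \<subseteq> X' \<union> Z \<and> s \<notin> N s \<and> 2 \<le> card (N s)" if "s \<in> X'" for s
      using Suc.prems(3)[of s] r(2)[of s] that unfolding X'_def by blast
    show "\<exists>r\<in>Y. \<forall>y\<in>Y. r \<notin> N y" if "Y \<subseteq> X'" "Y \<noteq> {}" for Y
      using Suc.prems(4)[of Y] that X' by blast
  qed (use that in auto)
  have step: "\<exists>A B. A \<subseteq> X \<union> Z \<and> B \<subseteq> X \<union> Z \<and> A \<inter> B = {} \<and> r \<in> A \<and> q \<in> B \<and>
           (\<forall>r\<in>A \<inter> X. N r \<inter> A \<noteq> {}) \<and> (\<forall>r\<in>B \<inter> X. N r \<inter> B \<noteq> {})"
    if q: "q \<in> X \<union> Z" "r \<noteq> q" for q
  proof -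
    have "\<not> N r \<subseteq> {q}"
    proof
      assume "N r \<subseteq> {q}"
      then have "card (N r) \<le> 1" using card_mono[of "{q}" "N r"] by simp
      then show False using Suc.prems(3)[OF r(1)] by simp
    qed
    then obtain p where p: "p \<in> N r" "p \<noteq> q" by blast
    have "p \<in> X' \<union> Z" "q \<in> X' \<union> Z"
      using p Suc.prems(3)[OF r(1)] q unfolding X'_def by auto
    from IH[OF this p(2)] obtain A B where AB: "A \<subseteq> X' \<union> Z" "B \<subseteq> X' \<union> Z" "A \<inter> B = {}" "p \<in> A"
      "q \<in> B" "\<forall>r\<in>A \<inter> X'. N r \<inter> A \<noteq> {}" "\<forall>r\<in>B \<inter> X'. N r \<inter> B \<noteq> {}"
      by auto
    have "r \<notin> B" using AB(2) r(1) Suc.prems(2) unfolding X'_def by blast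
    have "insert r A \<subseteq> X \<union> Z" "B \<subseteq> X \<union> Z" "insert r A \<inter> B = {}"
      using AB(1-3) r(1) X' \<open>r \<notin> B\<close> by auto
    moreover have "\<forall>s\<in>insert r A \<inter> X. N s \<inter> insert r A \<noteq> {}"
      using AB(4,6) p(1) unfolding X'_def by blast
    moreover have "\<forall>s\<in>B \<inter> X. N s \<inter> B \<noteq> {}"
      using AB(7) \<open>r \<notin> B\<close> unfolding X'_def by blast
    ultimately show ?thesis using AB(5)
      by (intro exI[of _ "insert r A"] exI[of _ B] conjI insertI1)
  qed
  consider "u = r" | "v = r" | "u \<noteq> r" "v \<noteq> r" by blast
  then show ?case
  proof cases
    case 1
    then show ?thesis using step[of v] Suc.prems by blast
  next
    case 2
    then have "r \<noteq> u" using Suc.prems(7) by blast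
    from step[OF Suc.prems(5) this] obtain A B where "A \<subseteq> X \<union> Z" "B \<subseteq> X \<union> Z" "B \<inter> A = {}"
      "r \<in> A" "u \<in> B" "\<forall>r\<in>A \<inter> X. N r \<inter> A \<noteq> {}" "\<forall>r\<in>B \<inter> X. N r \<inter> B \<noteq> {}"
      by (auto simp: Int_commute)
    then show ?thesis using 2 by (intro exI[of _ B] exI[of _ A] conjI) simp_all
  next
    case 3
    then have "u \<in> X' \<union> Z" "v \<in> X' \<union> Z" using Suc.prems unfolding X'_def by auto
    from IH[OF this Suc.prems(7)] obtain A B where AB: "A \<subseteq> X' \<union> Z" "B \<subseteq> X' \<union> Z" "A \<inter> B = {}"
      "u \<in> A" "v \<in> B" "\<forall>r\<in>A \<inter> X'. N r \<inter> A \<noteq> {}" "\<forall>r\<in>B \<inter> X'. N r \<inter> B \<noteq> {}"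
      by auto
    have "A \<inter> X = A \<inter> X'" "B \<inter> X = B \<inter> X'"
      using AB(1,2) r(1) Suc.prems(2) unfolding X'_def by auto
    then show ?thesis using AB X' by (intro exI[of _ A] exI[of _ B] conjI) auto
  qed
qed

text \<open>A sink \<open>p\<close> of the complement has \<open>N p\<close> inside
  \<open>A\<close>. If \<open>A\<close> has at most three elements, this forces
  \<open>N p = A\<close>; the last hypothesis is refuted or checked in that way below.\<close>

lemma friendly_side_complement_of_small:
  assumes reg: "out_regular3 V N" and "A \<subseteq> V" "A \<noteq> {}" "sinkless N A" "V - A \<noteq> {}"
    and "\<And>p. p \<in> V - A \<Longrightarrow> \<not> N p \<subseteq> A"
  shows "friendly_side V N A"
proof -
  have "N p \<inter> (V - A) \<noteq> {}" if "p \<in> V - A" for p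
    using assms(6)[OF that] out_regular3D(1)[OF reg, of p] that by blast
  then have "sinkless N (V - A)" unfolding sinkless_def by simp
  then show ?thesis using assms(2-5) unfolding friendly_side_def by simp
qed

section \<open>Digraphs with a digon\<close>

text \<open>The digon gives a first partition, fact \<open>D\<close>; under the contrary assumption
  any friendly side other than \<open>{x, y}\<close> and its complement is a contradiction.\<close>

lemma two_friendly_digon:
  assumes fin: "finite V" and reg: "out_regular3 V N"
    and IH: "\<And>W. W \<subset> V \<Longrightarrow> W \<noteq> {} \<Longrightarrow> out_regular3 W N \<Longrightarrow> two_friendly W N"
    and xy: "x \<in> V" "y \<in> V" "y \<in> N x" "x \<in> N y"
  shows "two_friendly V N"
proof (rule ccontr)
  assume no: "\<not> two_friendly V N"
  note N = out_regular3D[OF reg]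
  have ne: "x \<noteq> y" using N(2) xy by blast
  have digon: "friendly_side V N {p, q}" if "p \<in> V" "q \<in> V" "q \<in> N p" "p \<in> N q" for p q
  proof (rule friendly_side_complement_of_small[OF reg])
    show "sinkless N {p, q}" using that unfolding sinkless_def by blast
    have c: "card {p, q} \<le> 2" by (simp add: card_insert_if)
    show "\<not> N r \<subseteq> {p, q}" if "r \<in> V - {p, q}" for r
      using card_mono[of "{p,q}" "N r"] N(3)[of r] that c by auto
    show "V - {p, q} \<noteq> {}"
      using card_mono[of "{p,q}" "N p"] N(1,3)[of p] that c by auto
  qed (use that in auto)
  note D = digon[OF xy]
  define Z where "Z = {z \<in> V - {x, y}. x \<in> N z \<or> y \<in> N z}"
  define R where "R = V - {x, y} - Z"
  have move: "\<exists>u\<in>Z. N u = {x, y, v}" if v: "v \<in> Z" for v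
  proof (rule ccontr)
    assume neg: "\<not> (\<exists>u\<in>Z. N u = {x, y, v})"
    have vV: "v \<in> V" "v \<noteq> x" "v \<noteq> y" using v unfolding Z_def by auto
    have c: "card {x, y, v} = 3" using vV ne by simp
    have "friendly_side V N {x, y, v}"
    proof (rule friendly_side_complement_of_small[OF reg])
      show "sinkless N {x, y, v}" using xy v unfolding sinkless_def Z_def by blast
      show "V - {x, y, v} \<noteq> {}"
      proof
        assume "V - {x, y, v} = {}"
        then have "N v \<subseteq> {x, y}" using N(1,2)[OF vV(1)] by blast
        then show False using card_mono[of "{x,y}" "N v"] N(3)[OF vV(1)] ne by simp
      qed
      show "\<not> N p \<subseteq> {x, y, v}" if p: "p \<in> V - {x, y, v}" for p
      proof
        assume "N p \<subseteq> {x, y, v}"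
        then have "N p = {x, y, v}" using card_subset_eq[of "{x,y,v}" "N p"] N(3)[of p] p c by simp
        then show False using neg p unfolding Z_def by blast
      qed
    qed (use xy vV in auto)
    then show False using two_friendlyI[OF D] no vV by blast
  qed
  then obtain g where g: "\<And>v. v \<in> Z \<Longrightarrow> g v \<in> Z \<and> N (g v) = {x, y, v}" by metis
  have finZ: "finite Z" using fin unfolding Z_def by simp
  have notxy: "z \<noteq> x" "z \<noteq> y" if "z \<in> Z" for z using that unfolding Z_def by auto
  \<comment> \<open>\<open>v\<close> is the only element of \<open>N (g v)\<close> besides
    \<open>x\<close> and \<open>y\<close>. An injective self-map of a finite set is onto, so every
    vertex of \<open>Z\<close> has the form \<open>g v\<close>.\<close>
  have "inj_on g Z"
  proof (rule inj_onI)
    fix a b assume "a \<in> Z" "b \<in> Z" "g a = g b"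
    then have "{x, y, a} = {x, y, b}" using g by metis
    then show "a = b" using notxy \<open>a \<in> Z\<close> \<open>b \<in> Z\<close> by blast
  qed
  then have "g ` Z = Z" using finZ g by (intro endo_inj_surj) auto
  then have Z: "\<exists>v\<in>Z. N z = {x, y, v}" if "z \<in> Z" for z
    using g that by (metis imageE)
  have "Z \<noteq> {}"
  proof
    \<comment> \<open>With no arc entering the digon, its complement is closed under
      \<open>N\<close> and the induction hypothesis applies.\<close>
    assume Z0: "Z = {}"
    have "out_regular3 (V - {x, y}) N"
      unfolding out_regular3_def using N Z0 unfolding Z_def by blast
    moreover have "V - {x, y} \<noteq> {}" using D unfolding friendly_side_def by blast
    ultimately have "two_friendly (V - {x, y}) N" using IH[of "V - {x, y}"] xy by blast
    then show False using two_friendly_closed_subset[OF reg] no by blast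
  qed
  have sZ: "sinkless N Z" using Z unfolding sinkless_def by blast
  \<comment> \<open>All of \<open>Z\<close> dominates \<open>x\<close>, so an arc from
    \<open>x\<close> into \<open>Z\<close> would create a second digon and hence a second
    partition.\<close>
  have NxR: "N x - {y} \<subseteq> R"
  proof
    fix z assume z: "z \<in> N x - {y}"
    have "z \<notin> Z"
    proof
      assume "z \<in> Z"
      then have "x \<in> N z" "z \<in> V" "z \<noteq> x" "z \<noteq> y" using Z[of z] unfolding Z_def by auto
      then have "friendly_side V N {x, z}" using digon[of x z] z xy by blast
      then show False using two_friendlyI[OF D] no z ne \<open>z \<noteq> x\<close> by blast
    qed
    then show "z \<in> R" using z N(1,2)[OF xy(1)] unfolding R_def by blast
  qed
  have NyR: "N y - {x} \<subseteq> R"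
  proof
    fix z assume z: "z \<in> N y - {x}"
    have "z \<notin> Z"
    proof
      assume "z \<in> Z"
      then have "y \<in> N z" "z \<in> V" "z \<noteq> x" "z \<noteq> y" using Z[of z] unfolding Z_def by auto
      then have "friendly_side V N {y, z}" using digon[of y z] z xy by blast
      then show False using two_friendlyI[OF D] no z ne \<open>z \<noteq> y\<close> by blast
    qed
    then show "z \<in> R" using z N(1,2)[OF xy(2)] unfolding R_def by blast
  qed
  \<comment> \<open>A sinkless \<open>C\<close> in \<open>R\<close> could be separated from the
    sinkless set \<open>Z\<close>, whereas the digon partition keeps \<open>R\<close> and
    \<open>Z\<close> together. Hence \<open>R\<close> is acyclic.\<close>
  have noC: "\<not> (C \<subseteq> R \<and> C \<noteq> {} \<and> sinkless N C)" for C
  proof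
    assume C: "C \<subseteq> R \<and> C \<noteq> {} \<and> sinkless N C"
    have "Z \<subseteq> V" "C \<subseteq> V" "Z \<inter> C = {}" "Z \<noteq> {}" "C \<noteq> {}" "sinkless N Z" "sinkless N C"
      using C sZ \<open>Z \<noteq> {}\<close> unfolding R_def Z_def by auto
    then obtain S where S: "friendly_side V N S" "Z \<subseteq> S" "C \<subseteq> V - S"
      by (rule extend_to_friendly_side[OF reg])
    have "S \<noteq> {x, y}" using S(2) \<open>Z \<noteq> {}\<close> unfolding Z_def by blast
    moreover have "S \<noteq> V - {x, y}" using S(3) C unfolding R_def by blast
    ultimately show False using two_friendlyI[OF D S(1)] no by blast
  qed
  obtain s where s: "s \<in> N x - {y}"
    using card_mono[of "{y}" "N x"] N(3)[OF xy(1)] by auto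
  obtain t where t: "t \<in> N y - {x}" "t \<noteq> s"
  proof -
    have "\<not> N y \<subseteq> {x, s}"
    proof
      assume "N y \<subseteq> {x, s}"
      then have "card (N y) \<le> card {x, s}" by (intro card_mono) auto
      then show False using N(3)[OF xy(2)] by (simp add: card_insert_if split: if_splits)
    qed
    then show thesis using that by blast
  qed
  have "\<exists>A B. A \<subseteq> R \<union> Z \<and> B \<subseteq> R \<union> Z \<and> A \<inter> B = {} \<and> s \<in> A \<and> t \<in> B \<and>
           (\<forall>r\<in>A \<inter> R. N r \<inter> A \<noteq> {}) \<and> (\<forall>r\<in>B \<inter> R. N r \<inter> B \<noteq> {})"
  proof (rule disjoint_linkage)
    show "finite R" using fin unfolding R_def by simp
    show "R \<inter> Z = {}" unfolding R_def by blast
    show "N r \<subseteq> R \<union> Z \<and> r \<notin> N r \<and> 2 \<le> card (N r)" if "r \<in> R" for r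
      using that N(1-3)[of r] unfolding R_def Z_def by auto
    show "\<exists>r\<in>Y. \<forall>y\<in>Y. r \<notin> N y" if Y: "Y \<subseteq> R" "Y \<noteq> {}" for Y
    proof (rule ccontr)
      assume "\<not> ?thesis"
      then have "\<And>r. r \<in> Y \<Longrightarrow> \<exists>y\<in>Y. r \<in> N y" by blast
      moreover have "finite Y" using Y(1) \<open>finite R\<close> finite_subset by blast
      ultimately obtain C where "C \<subseteq> Y" "C \<noteq> {}" "sinkless N C"
        using sourceless_imp_sinkless_subset Y(2) by metis
      then show False using noC Y(1) by blast
    qed
  qed (use s t NxR NyR in auto)
  then obtain A B where AB: "A \<subseteq> R \<union> Z" "B \<subseteq> R \<union> Z" "A \<inter> B = {}" "s \<in> A" "t \<in> B"
    "\<forall>r\<in>A \<inter> R. N r \<inter> A \<noteq> {}" "\<forall>r\<in>B \<inter> R. N r \<inter> B \<noteq> {}"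
    by auto
  have RZ: "R \<union> Z = V - {x, y}" unfolding R_def Z_def by blast
  have Zxy: "x \<in> N z" "y \<in> N z" if "z \<in> Z" for z using Z[OF that] by auto
  have "insert x A \<subseteq> V" "insert y B \<subseteq> V" "insert x A \<inter> insert y B = {}"
    "insert x A \<noteq> {}" "insert y B \<noteq> {}"
    using AB(1-3) RZ xy ne by auto
  \<comment> \<open>The path closes up: \<open>x\<close> has an arc to \<open>s\<close>, vertices of
    \<open>A\<close> in \<open>R\<close> continue inside \<open>A\<close>, and those in
    \<open>Z\<close> return to \<open>x\<close>.\<close>
  moreover have "sinkless N (insert x A)"
    using AB(1,4,6) s Zxy unfolding sinkless_def by blast
  moreover have "sinkless N (insert y B)"
    using AB(2,5,7) t Zxy unfolding sinkless_def by blast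
  ultimately obtain S where "friendly_side V N S" "insert x A \<subseteq> S" "insert y B \<subseteq> V - S"
    by (rule extend_to_friendly_side[OF reg])
  then show False using two_friendlyI[OF D] no by blast
qed

section \<open>Contracting an arc\<close>

text \<open>\<open>M\<close> redirects arcs into \<open>u\<close> to \<open>v\<close>. Lack of a
  common in-neighbour keeps the out-degree at three, and \<open>u \<notin> N v\<close> prevents a
  loop at \<open>v\<close>.\<close>

lemma two_friendly_contract:
  assumes reg: "out_regular3 V N" and uv: "u \<in> V" "v \<in> N u" "u \<notin> N v"
    and IH: "\<And>M. out_regular3 (V - {u}) M \<Longrightarrow> two_friendly (V - {u}) M"
    and common: "\<And>z. z \<in> V \<Longrightarrow> \<not> (u \<in> N z \<and> v \<in> N z)"
  shows "two_friendly V N"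
proof -
  note N = out_regular3D[OF reg]
  define M where "M p = (if u \<in> N p then insert v (N p - {u}) else N p)" for p
  have v: "v \<in> V" "v \<noteq> u" using N(1,2)[OF uv(1)] uv(2) by auto
  have "out_regular3 (V - {u}) M"
    unfolding out_regular3_def
  proof
    fix p assume p: "p \<in> V - {u}"
    show "M p \<subseteq> V - {u} \<and> p \<notin> M p \<and> card (M p) = 3"
    proof (cases "u \<in> N p")
      case True
      then have "v \<notin> N p" "p \<noteq> v" using common[of p] p uv(3) by auto
      then show ?thesis using N[of p] p v True unfolding M_def by auto
    next
      case False
      then show ?thesis using N[of p] p unfolding M_def by auto
    qed
  qed
  from IH[OF this] obtain A B where AB: "friendly_side (V - {u}) M A"
    "friendly_side (V - {u}) M B" "B \<noteq> A" "B \<noteq> V - {u} - A"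
    unfolding two_friendly_def by blast
  \<comment> \<open>\<open>u\<close> rejoins the part containing \<open>v\<close>. Its arc to
    \<open>v\<close> then stays inside, and redirected arcs can be turned back to
    \<open>u\<close>.\<close>
  define up where "up X = (if v \<in> X then insert u X else X)" for X
  have sink: "sinkless N (up X)" if X: "sinkless M X" "u \<notin> X" for X
    unfolding sinkless_def
  proof
    fix p assume p: "p \<in> up X"
    show "N p \<inter> up X \<noteq> {}"
    proof (cases "p = u")
      case True
      then show ?thesis using p X(2) uv(2) unfolding up_def by (auto split: if_splits)
    next
      case False
      then have "p \<in> X" using p unfolding up_def by (auto split: if_splits)
      then obtain q where q: "q \<in> M p" "q \<in> X" using X(1) unfolding sinkless_def by blast
      then show ?thesis unfolding M_def up_def by (auto split: if_splits)
    qed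
  qed
  have lift: "friendly_side V N (up X)" if "friendly_side (V - {u}) M X" for X
  proof -
    have "V - up X = up (V - {u} - X)"
      using that v uv(1) unfolding friendly_side_def up_def by auto
    moreover have "sinkless N (up X)" "sinkless N (up (V - {u} - X))"
      using that by (auto intro!: sink simp: friendly_side_def)
    moreover have "up X \<subseteq> V" "up X \<noteq> {}" "up (V - {u} - X) \<noteq> {}"
      using that uv(1) unfolding friendly_side_def up_def by auto
    ultimately show ?thesis unfolding friendly_side_def by simp
  qed
  have "up X - {u} = X" if "friendly_side (V - {u}) M X" for X
    using that unfolding friendly_side_def up_def by auto
  then have e: "up A - {u} = A" "up B - {u} = B" using AB(1,2) by auto
  have "up B \<noteq> up A" using e AB(3) by metis
  moreover have "up B \<noteq> V - up A"
  proof
    assume "up B = V - up A"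
    then have "B = V - {u} - A" using e by blast
    then show False using AB(4) by blast
  qed
  ultimately show ?thesis using lift AB(1,2) two_friendlyI by metis
qed

section \<open>Digraphs whose in-neighbourhoods are directed triangles\<close>

lemma two_friendly_triangular:
  assumes reg: "out_regular3 V N" and "V \<noteq> {}"
    and dig: "\<And>p q. p \<in> V \<Longrightarrow> q \<in> N p \<Longrightarrow> p \<notin> N q"
    and I: "\<And>v. I v = {p \<in> V. v \<in> N p}"
    and tri: "\<And>v. v \<in> V \<Longrightarrow> \<exists>a b c. I v = {a, b, c} \<and> b \<in> N a \<and> c \<in> N b \<and> a \<in> N c"
  shows "two_friendly V N"
proof (rule ccontr)
  assume no: "\<not> two_friendly V N"
  note N = out_regular3D[OF reg]
  have sI: "sinkless N (I v)" "I v \<noteq> {}" "I v \<subseteq> V" if "v \<in> V" for v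
  proof -
    show "sinkless N (I v)" "I v \<noteq> {}" using tri[OF that] unfolding sinkless_def by auto
    show "I v \<subseteq> V" unfolding I by blast
  qed
  have triangle: "friendly_side V N T \<or> (\<exists>w\<in>V. N w = T)"
    if T: "T = {a, b, c}" "T \<subseteq> V" "b \<in> N a" "c \<in> N b" "a \<in> N c" "q \<in> V - T" for T a b c q
  proof (rule disjCI)
    assume nw: "\<not> (\<exists>w\<in>V. N w = T)"
    have "card T \<le> 3" unfolding T(1) by (simp add: card_insert_if)
    have fT: "finite T" using T(1) by simp
    show "friendly_side V N T"
    proof (rule friendly_side_complement_of_small[OF reg T(2)])
      show "\<not> N p \<subseteq> T" if "p \<in> V - T" for p
        using card_seteq[OF fT, of "N p"] nw that N(3)[of p] \<open>card T \<le> 3\<close> by auto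
    qed (use T in \<open>auto simp: sinkless_def\<close>)
  qed
  \<comment> \<open>Without digons, \<open>N w\<close> and \<open>I w\<close> are disjoint, and
    \<open>I w\<close> is a triangle.\<close>
  have inout: "\<exists>S. friendly_side V N S \<and> N w \<subseteq> S \<and> I w \<subseteq> V - S"
    if "w \<in> V" "sinkless N (N w)" for w
  proof -
    have "N w \<inter> I w = {}" using dig that(1) unfolding I by blast
    then show ?thesis
      using extend_to_friendly_side[OF reg N(1)[OF that(1)] sI(3)[OF that(1)] _ N(5)[OF that(1)]
          sI(2)[OF that(1)] that(2) sI(1)[OF that(1)]] by metis
  qed
  \<comment> \<open>For \<open>b\<close> in \<open>I v\<close>, the triangles \<open>I v\<close> and
    \<open>I b\<close> share \<open>a\<close> but only the first contains \<open>b\<close>. They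
    cannot both be friendly sides, so one of them is an out-neighbourhood.\<close>
  obtain w a b c where w: "w \<in> V" "N w = {a, b, c}" "b \<in> N a" "c \<in> N b" "a \<in> N c"
  proof -
    obtain v where v: "v \<in> V" using assms(2) by blast
    obtain a b c where abc: "I v = {a, b, c}" "b \<in> N a" "c \<in> N b" "a \<in> N c" using tri[OF v] by blast
    then have V: "a \<in> V" "b \<in> V" "c \<in> V" using sI(3)[OF v] by auto
    have "v \<notin> I v" using N(2)[OF v] unfolding I by blast
    then have 1: "friendly_side V N (I v) \<or> (\<exists>w\<in>V. N w = I v)"
      using triangle[OF abc(1) sI(3)[OF v] abc(2-4)] v by blast
    obtain d e f where de: "I b = {d, e, f}" "e \<in> N d" "f \<in> N e" "d \<in> N f" using tri[OF V(2)] by blast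
    have "b \<notin> I b" using N(2)[OF V(2)] unfolding I by blast
    then have 2: "friendly_side V N (I b) \<or> (\<exists>w\<in>V. N w = I b)"
      using triangle[OF de(1) sI(3)[OF V(2)] de(2-4)] V by blast
    have "a \<in> I b" using abc V unfolding I by blast
    then have "I b \<noteq> I v" "I b \<noteq> V - I v" using abc(1) \<open>b \<notin> I b\<close> by auto
    then have "\<not> (friendly_side V N (I v) \<and> friendly_side V N (I b))"
      using two_friendlyI[of V N "I v" "I b"] no by blast
    then show thesis using 1 2 abc de that by metis
  qed
  have V: "a \<in> V" "b \<in> V" "c \<in> V" using w N(1)[OF w(1)] by auto
  have "sinkless N (N w)" using w unfolding sinkless_def by auto
  then obtain S where S: "friendly_side V N S" "N w \<subseteq> S" using inout[OF w(1)] by blast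
  \<comment> \<open>\<open>w\<close> and \<open>p\<close> are in-neighbours of \<open>q\<close>
    joined by an arc from \<open>w\<close> to \<open>p\<close>; this fixes the orientation of the
    triangle \<open>I q\<close>.\<close>
  have third: "\<exists>z. I q = {w, p, z} \<and> z \<in> N p \<and> w \<in> N z"
    if pq: "p \<in> N w" "q \<in> N w" "q \<in> N p" for p q
  proof -
    have qV: "q \<in> V" "p \<in> V" using pq N(1)[OF w(1)] by auto
    obtain d e f where de: "I q = {d, e, f}" "e \<in> N d" "f \<in> N e" "d \<in> N f" using tri[OF qV(1)] by blast
    have "w \<in> {d, e, f}" "p \<in> {d, e, f}" using pq qV w(1) de(1) unfolding I by auto
    moreover have "w \<noteq> p" using N(2)[OF w(1)] pq by blast
    moreover have "w \<notin> N p" using dig[OF w(1) pq(1)] .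
    ultimately show ?thesis using de by (elim insertE emptyE) (auto simp: insert_commute)
  qed
  obtain z where z: "I a = {w, c, z}" "z \<in> N c" "w \<in> N z" using third[of c a] w by auto
  obtain z' where z': "I b = {w, a, z'}" "z' \<in> N a" "w \<in> N z'" using third[of a b] w by auto
  have z'V: "z' \<in> V" using z'(1) unfolding I by blast
  have bn: "b \<notin> {w, a, z'}" using z'(1) N(2)[OF V(2)] unfolding I by blast
  have "friendly_side V N {w, a, z'} \<or> (\<exists>p\<in>V. N p = {w, a, z'})"
    by (rule triangle[OF refl, of w a z' b]) (use w V z' z'V bn in auto)
  \<comment> \<open>\<open>S\<close> contains both \<open>a\<close> and \<open>b\<close>, while this
    triangle contains only \<open>a\<close>; as a friendly side it would give a second
    partition.\<close>
  moreover have "\<not> friendly_side V N {w, a, z'}"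
    using two_friendlyI[OF S(1), of "{w, a, z'}"] no S(2) bn w(2) by auto
  ultimately obtain p where p: "p \<in> V" "N p = {w, a, z'}" by blast
  \<comment> \<open>Excluding \<open>w\<close> (a loop) and \<open>c\<close> (a digon with
    \<open>w\<close>) leaves \<open>p = z\<close>, an out-neighbour of \<open>c\<close>. Thus
    \<open>S'\<close> separates \<open>a\<close> from \<open>c\<close>, which \<open>S\<close> does
    not.\<close>
  have "p \<in> {w, c, z}" using p z(1) unfolding I by blast
  moreover have "p \<noteq> w" using N(2)[OF p(1)] p(2) by blast
  moreover have "p \<noteq> c" using dig[OF w(1), of c] w(2) p(2) by blast
  ultimately have "c \<in> I p" using z(2) V unfolding I by blast
  have "sinkless N (N p)" using p w z' unfolding sinkless_def by auto
  then obtain S' where S': "friendly_side V N S'" "N p \<subseteq> S'" "I p \<subseteq> V - S'"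
    using inout[OF p(1)] by blast
  have "a \<in> S'" "c \<notin> S'" "a \<in> S" "c \<in> S" using S' S p w \<open>c \<in> I p\<close> by auto
  then show False using two_friendlyI[OF S(1) S'(1)] no by blast
qed

section \<open>The induction on the number of vertices\<close>

lemma two_friendly_out_regular3:
  assumes "finite V" "V \<noteq> {}" "out_regular3 V N"
  shows "two_friendly V N"
  using assms
proof (induction "card V" arbitrary: V N rule: less_induct)
  case less
  note reg = less.prems(3)
  note N = out_regular3D[OF reg]
  \<comment> \<open>\<open>M\<close> varies because contraction changes the
    out-neighbourhoods.\<close>
  have IH: "two_friendly W M" if "W \<subset> V" "W \<noteq> {}" "out_regular3 W M" for W M
  proof (rule less.hyps)
    show "card W < card V" using less.prems(1) that(1) by (rule psubset_card_mono)
    show "finite W" using less.prems(1) that(1) by (auto intro: finite_subset)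
  qed (use that in auto)
  have ne: "V - {v} \<noteq> {}" if "v \<in> V" for v
    using N(1,2,5)[OF that] by blast
  show ?case
  proof (rule ccontr)
    assume no: "\<not> ?thesis"
    have dig: "p \<notin> N q" if "p \<in> V" "q \<in> N p" for p q
      using two_friendly_digon[OF less.prems(1) reg, of p q] IH that N(1)[OF that(1)] no by blast
    have common: "\<exists>z\<in>V. u \<in> N z \<and> v \<in> N z" if "u \<in> V" "v \<in> N u" for u v
      using two_friendly_contract[OF reg that dig[OF that]] IH[of "V - {u}"] ne[OF that(1)] that(1) no
      by blast
    define I where "I v = {p \<in> V. v \<in> N p}" for v
    have finI: "finite (I v)" for v using less.prems(1) unfolding I_def by simp
    have Ine: "I v \<noteq> {}" if "v \<in> V" for v
    proof
      assume "I v = {}"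
      then have "out_regular3 (V - {v}) N"
        using N unfolding out_regular3_def I_def by blast
      then have "two_friendly (V - {v}) N" using IH ne[OF that] that by blast
      then show False using two_friendly_closed_subset[OF reg] no by blast
    qed
    \<comment> \<open>Taking common in-neighbours with \<open>v\<close> repeatedly climbs from
      \<open>c\<close> to \<open>b\<close> to \<open>a\<close>; the absence of digons gives
      \<open>a \<noteq> c\<close>.\<close>
    have chain: "\<exists>a b c. {a, b, c} \<subseteq> I v \<and> card {a, b, c} = 3 \<and> b \<in> N a \<and> c \<in> N b" if v: "v \<in> V" for v
    proof -
      obtain c where c: "c \<in> V" "v \<in> N c" using Ine[OF v] unfolding I_def by blast
      obtain b where b: "b \<in> V" "c \<in> N b" "v \<in> N b" using common[OF c] by blast
      obtain a where a: "a \<in> V" "b \<in> N a" "v \<in> N a" using common[OF b(1,3)] by blast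
      have "a \<noteq> b" "b \<noteq> c" "a \<noteq> c" using N(2) a b c dig[OF b(1,2)] by auto
      then show ?thesis using a b c unfolding I_def by (intro exI[of _ a] exI[of _ b] exI[of _ c]) auto
    qed
    have ge: "3 \<le> card (I v)" if "v \<in> V" for v
      using chain[OF that] card_mono[OF finI[of v]] by metis
    \<comment> \<open>Counting arcs by head and by tail: in-degrees are at least three and average
      three, so all equal three.\<close>
    have "(\<Sum>v\<in>V. card (I v)) = (\<Sum>v\<in>V. card (N v))"
    proof -
      have "(\<Sum>v\<in>V. card (I v)) = (\<Sum>v\<in>V. \<Sum>p\<in>V. if v \<in> N p then 1 else 0)"
        using less.prems(1) unfolding I_def by (simp add: sum.If_cases Int_def)
      also have "\<dots> = (\<Sum>p\<in>V. \<Sum>v\<in>V. if v \<in> N p then 1 else 0)" by (rule sum.swap)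
      also have "\<dots> = (\<Sum>p\<in>V. card (N p))"
      proof (rule sum.cong[OF refl])
        fix p assume "p \<in> V"
        then have "V \<inter> N p = N p" using N(1) by blast
        then show "(\<Sum>v\<in>V. if v \<in> N p then 1 else 0) = card (N p)"
          using less.prems(1) by (simp add: sum.If_cases)
      qed
      finally show ?thesis .
    qed
    also have "\<dots> = (\<Sum>v\<in>V. 3)" using N(3) by (intro sum.cong) auto
    finally have sum: "(\<Sum>v\<in>V. 3) = (\<Sum>v\<in>V. card (I v))" by simp
    have eq: "card (I v) = 3" if "v \<in> V" for v
      using sum_mono_inv[OF sum ge that less.prems(1)] by simp
    have tri: "\<exists>a b c. I v = {a, b, c} \<and> b \<in> N a \<and> c \<in> N b \<and> a \<in> N c" if v: "v \<in> V" for v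
    proof -
      obtain a b c where abc: "{a, b, c} \<subseteq> I v" "card {a, b, c} = 3" "b \<in> N a" "c \<in> N b"
        using chain[OF v] by blast
      then have Iv: "I v = {a, b, c}" using card_subset_eq[OF finI] eq[OF v] by metis
      have a: "a \<in> V" "v \<in> N a" using abc(1) unfolding I_def by auto
      \<comment> \<open>This common in-neighbour of \<open>a\<close> and \<open>v\<close> lies in
        \<open>I v\<close> and is neither \<open>a\<close> nor \<open>b\<close>, so it is
        \<open>c\<close> and closes the triangle.\<close>
      obtain z where z: "z \<in> V" "a \<in> N z" "v \<in> N z" using common[OF a] by blast
      then have "z \<in> {a, b, c}" using Iv unfolding I_def by blast
      moreover have "z \<noteq> a" using N(2)[OF a(1)] z by blast
      moreover have "z \<noteq> b" using dig[OF a(1) abc(3)] z by blast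
      ultimately show ?thesis using Iv abc z by blast
    qed
    show False
      using two_friendly_triangular[OF reg less.prems(2) dig I_def tri] no by blast
  qed
qed

section \<open>Transfer to digraphs\<close>

theorem theorem1p7:
  fixes G :: "('a, 'b) pre_digraph"
  assumes "digraph G"
    and "verts G \<noteq> {}"
    and "min_out_degree G \<ge> 3"
  shows "card {P. friendly_partition G P} \<ge> 2"
proof -
  interpret digraph G by (rule assms(1))
  define V where "V = verts G"
  have fin: "finite V" unfolding V_def by simp
  have "\<exists>T. T \<subseteq> {w. v \<rightarrow>\<^bsub>G\<^esub> w} \<and> card T = 3" if "v \<in> V" for v
  proof -
    have "3 \<le> out_degree G v"
      using assms(3) that fin unfolding min_out_degree_def V_def
      by (meson Min_le finite_imageI image_eqI le_trans)
    \<comment> \<open>Without parallel arcs, counting out-arcs is counting out-neighbours.\<close>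
    also have "out_degree G v = card (head G ` out_arcs G v)"
      unfolding out_degree_def
      by (rule card_image[symmetric], rule inj_onI)
        (metis arc_to_ends_def in_out_arcs_conv no_multi_arcs)
    finally obtain T where "T \<subseteq> head G ` out_arcs G v" "card T = 3"
      using obtain_subset_with_card_n by blast
    moreover have "head G ` out_arcs G v \<subseteq> {w. v \<rightarrow>\<^bsub>G\<^esub> w}"
      by (auto simp: arcs_ends_def arc_to_ends_def)
    ultimately show ?thesis by blast
  qed
  then obtain N where N: "\<And>v. v \<in> V \<Longrightarrow> N v \<subseteq> {w. v \<rightarrow>\<^bsub>G\<^esub> w} \<and> card (N v) = 3" by metis
  have "out_regular3 V N"
    unfolding out_regular3_def
  proof
    fix v assume v: "v \<in> V"
    have "w \<in> V \<and> w \<noteq> v" if "v \<rightarrow>\<^bsub>G\<^esub> w" for w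
      using that adj_not_same adj_in_verts unfolding V_def by blast
    then show "N v \<subseteq> V \<and> v \<notin> N v \<and> card (N v) = 3" using N[OF v] by blast
  qed
  then obtain A B where AB: "friendly_side V N A" "friendly_side V N B" "B \<noteq> A" "B \<noteq> V - A"
    using two_friendly_out_regular3[OF fin] assms(2) V_def unfolding two_friendly_def by metis
  have fp: "friendly_partition G {X, V - X}" if "friendly_side V N X" for X
  proof -
    have X: "X \<subseteq> V" "X \<noteq> {}" "V - X \<noteq> {}" "sinkless N X" "sinkless N (V - X)"
      using that unfolding friendly_side_def by auto
    have "partition_on V {X, V - X}"
      using X by (intro partition_onI) (auto simp: disjnt_def)
    moreover have "X \<noteq> V - X" using X(2) by blast
    then have "card {X, V - X} = 2" by simp
    moreover have "\<exists>w\<in>Y. v \<rightarrow>\<^bsub>G\<^esub> w" if Y: "Y \<in> {X, V - X}" "v \<in> Y" for Y v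
    proof -
      have "sinkless N Y" "v \<in> V" using Y X by auto
      then obtain w where "w \<in> N v" "w \<in> Y" using Y(2) unfolding sinkless_def by blast
      then show ?thesis using N[OF \<open>v \<in> V\<close>] by blast
    qed
    ultimately show ?thesis unfolding friendly_partition_def V_def by blast
  qed
  \<comment> \<open>Finiteness matters for the lower bound, since \<open>card\<close> of an infinite
    set is 0.\<close>
  have "{P. friendly_partition G P} \<subseteq> Pow (Pow V)"
    unfolding friendly_partition_def partition_on_def V_def by blast
  then have "finite {P. friendly_partition G P}" using fin by (meson finite_Pow_iff finite_subset)
  then have "card {{A, V - A}, {B, V - B}} \<le> card {P. friendly_partition G P}"
    using fp AB(1,2) by (intro card_mono) auto
  moreover have "{A, V - A} \<noteq> {B, V - B}" using AB(3,4) by blast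
  ultimately show ?thesis by simp
qed

end
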